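(* Let $j\in\{1,2,3\}$ and let $(\underline{\hat x},\underline{\hat u})=((\hat x_t)_{t\in\mathbb N},(\hat u_t)_{t\in\mathbb N})$ be a solution of problem $(P^j_i)$ (defined in the context). Assume: (i) For all $t\in\mathbb N$, $\hat u_t\in \operatorname{int} U_t$ (topological interior in $\mathbb R^d$). (ii) For all $t\in\mathbb N$, $\phi_t$ and $f_t$ are Gâteaux differentiable at $(\hat x_t,\hat u_t)$. (iii) For all $t\in\mathbb N$ and all $\alpha\in\{1,\dots,n\}$, the coordinate function $f_t^\alpha$ is lower semicontinuous at $(\hat x_t,\hat u_t)$ whenever $f_t^\alpha(\hat x_t,\hat u_t)>\hat x_{t+1}^\alpha$. (v) For all $t\in\mathbb N_*$: $\frac{\partial f_t^\alpha(\hat x_t,\hat u_t)}{\partial x^\beta}\ge0$ for all $\alpha,\beta\in\{1,\dots,n\}$, and $\frac{\partial f_t^\alpha(\hat x_t,\hat u_t)}{\partial x^\alpha}>0$ for all $\alpha\in\{1,\dots,n\}$. Then there exist $\lambda_0\in\mathbb R$ and $(p_t)_{t\in\mathbb N_*}\in(\mathbb R^{n*})^{\mathbb N_*}$ such that: (NN) $(\lambda_0,p_1)\neq(0,0)$. (Si) $\lambda_0\ge 0$ and $p_t\ge 0$ for all $t\in\mathbb N_*$. (S$\ell$) For all $t\in\mathbb N$ and all $\alpha\in\{1,\dots,n\}$, $p_{t+1}^\alpha\cdot(f_t^\alpha(\hat x_t,\hat u_t)-\hat x_{t+1}^\alpha)=0$. (AE) For all $t\in\mathbb N_*$, $p_t=p_{t+1}\circ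 D_{G,1}f_t(\hat x_t,\hat u_t)+\lambda_0 D_{G,1}\phi_t(\hat x_t,\hat u_t)$. (WM) For all $t\in\mathbb N$, $p_{t+1}\circ D_{G,2}f_t(\hat x_t,\hat u_t)+\lambda_0D_{G,2}\phi_t(\hat x_t,\hat u_t)=0$.
   Context: $\mathbb N=\{0,1,2,\dots\}$, $\mathbb N_*=\mathbb N\setminus\{0\}$. For each $t\in\mathbb N$, $X_t$ is a nonempty open subset of $\mathbb R^n$, $U_t$ is a nonempty subset of $\mathbb R^d$, $f_t:X_t\times U_t\to X_{t+1}$ is a mapping with coordinates $f_t^\alpha$, $1\le\alpha\le n$, and $\phi_t:X_t\times U_t\to\mathbb R$ is a function. A point $\sigma\in X_0$ is fixed. The order on $\mathbb R^n$ is coordinatewise: $x\le y$ iff $x^\alpha\le y^\alpha$ for all $\alpha$. $\mathbb R^{n*}$ is the dual of $\mathbb R^n$; $p\in\mathbb R^{n*}$ has coordinates $p^\alpha$ in the canonical dual basis and $p\ge 0$ means $p^\alpha\ge0$ for all $\alpha$. $\mathrm{Adm}_i$ is the set of $(\underline x,\underline u)=((x_t)_{t\in\mathbb N},(u_t)_{t\in\mathbb N})\in\prod_{t\in\mathbb N}X_t\times\prod_{t\in\mathbb N}U_t$ such that $x_0=\sigma$ and $x_{t+1}\le f_t(x_t,u_t)$ for all $t\in\mathbb N$. $\mathrm{Dom}_i$ is the set of $(\underline x,\underline u)\in\mathrm{Adm}_i$ such that the series $\sum_{t=0}^{+\infty}\phi_t(x_t,u_t)$ converges in $\mathbb R$,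 and $J(\underline x,\underline u):=\sum_{t=0}^{+\infty}\phi_t(x_t,u_t)$ on $\mathrm{Dom}_i$. The problems are: $(P^1_i)$: maximize $J(\underline x,\underline u)$ over $(\underline x,\underline u)\in\mathrm{Dom}_i$. $(P^2_i)$: find $(\underline{\hat x},\underline{\hat u})\in\mathrm{Adm}_i$ such that for all $(\underline x,\underline u)\in\mathrm{Adm}_i$, $\limsup_{h\to+\infty}\left(\sum_{t=0}^h\phi_t(\hat x_t,\hat u_t)-\sum_{t=0}^h\phi_t(x_t,u_t)\right)\ge0$. $(P^3_i)$: the same with $\liminf$ in place of $\limsup$. Gâteaux differentiability: for finite-dimensional real normed spaces $E,F$, $A\subset E$, $\Phi:A\to F$ and $a\in A$, $\Phi$ is Gâteaux differentiable at $a$ when for all $v\in E$ the limit $\vec D\Phi(a,v):=\lim_{s\to0}\frac1s(\Phi(a+sv)-\Phi(a))$ exists and $v\mapsto\vec D\Phi(a,v)$ is linear; then $D_G\Phi(a)v:=\vec D\Phi(a,v)$. If $E=E_1\times E_2$ and $a=(a_1,a_2)$, $D_{G,1}\Phi(a)$ (resp. $D_{G,2}\Phi(a)$) is the Gâteaux differential of $\Phi(\cdot,a_2)$ at $a_1$ (resp. of $\Phi(a_1,\cdot)$ at $a_2$). The numbers $\frac{\partial f_t^\alpha(\hat x_t,\hat u_t)}{\partial x^\beta}$ are the partial derivatives of $f^\alpha_t$ with respect to the coordinates of the first variable $x\in\mathbb R^n$, i.e. the entries of the matrix of $D_{G,1}f_t(\hat x_t,\hat u_t)$. *)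

theory Defs
  imports "HOL-Analysis.Analysis"
begin

text \<open>
  HOL functions are total, so the domain A of a partial map is an explicit argument, and limits are
  taken along the s for which a + s v lies in A. When a is an interior point of A this is the
  ordinary two-sided limit as s tends to 0.
\<close>

definition gateaux_quotient ::
  "('a::real_normed_vector \<Rightarrow> 'b::real_normed_vector) \<Rightarrow> 'a \<Rightarrow> 'a \<Rightarrow> real \<Rightarrow> 'b" where
  "gateaux_quotient \<Phi> a v s = (1 / s) *\<^sub>R (\<Phi> (a + s *\<^sub>R v) - \<Phi> a)"

definition gateaux_deriv ::
  "'a::real_normed_vector set \<Rightarrow> ('a \<Rightarrow> 'b::real_normed_vector) \<Rightarrow> 'a \<Rightarrow> 'a \<Rightarrow> 'b" where
  "gateaux_deriv A \<Phi> a v = Lim (at 0 within {s. a + s *\<^sub>R v \<in> A}) (gateaux_quotient \<Phi> a v)"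

definition gateaux_differentiable ::
  "'a::real_normed_vector set \<Rightarrow> ('a \<Rightarrow> 'b::real_normed_vector) \<Rightarrow> 'a \<Rightarrow> bool" where
  "gateaux_differentiable A \<Phi> a \<longleftrightarrow>
     (\<forall>v. \<exists>l. (gateaux_quotient \<Phi> a v \<longlongrightarrow> l) (at 0 within {s. a + s *\<^sub>R v \<in> A})) \<and>
     linear (gateaux_deriv A \<Phi> a)"

definition gateaux_deriv1 ::
  "('a::real_normed_vector \<times> 'c::real_normed_vector) set \<Rightarrow> ('a \<times> 'c \<Rightarrow> 'b::real_normed_vector)
   \<Rightarrow> 'a \<times> 'c \<Rightarrow> 'a \<Rightarrow> 'b" where
  "gateaux_deriv1 A \<Phi> a = gateaux_deriv {x. (x, snd a) \<in> A} (\<lambda>x. \<Phi> (x, snd a)) (fst a)"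

definition gateaux_deriv2 ::
  "('a::real_normed_vector \<times> 'c::real_normed_vector) set \<Rightarrow> ('a \<times> 'c \<Rightarrow> 'b::real_normed_vector)
   \<Rightarrow> 'a \<times> 'c \<Rightarrow> 'c \<Rightarrow> 'b" where
  "gateaux_deriv2 A \<Phi> a = gateaux_deriv {u. (fst a, u) \<in> A} (\<lambda>u. \<Phi> (fst a, u)) (snd a)"

definition partial_x ::
  "((real^'n) \<times> 'c::real_normed_vector) set \<Rightarrow> ((real^'n) \<times> 'c \<Rightarrow> real^'n)
   \<Rightarrow> (real^'n) \<times> 'c \<Rightarrow> 'n \<Rightarrow> 'n \<Rightarrow> real" where
  "partial_x A F a \<alpha> \<beta> = matrix (gateaux_deriv1 A F a) $ \<alpha> $ \<beta>"

definition lsc_at :: "'a::topological_space set \<Rightarrow> ('a \<Rightarrow> real) \<Rightarrow> 'a \<Rightarrow> bool" where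
  "lsc_at A g a \<longleftrightarrow> (\<forall>y < g a. \<forall>\<^sub>F z in at a within A. y < g z)"

definition dual_coord :: "((real^'n) \<Rightarrow>\<^sub>L real) \<Rightarrow> 'n \<Rightarrow> real" where
  "dual_coord p \<alpha> = blinfun_apply p (axis \<alpha> 1)"

definition dual_nonneg :: "((real^'n) \<Rightarrow>\<^sub>L real) \<Rightarrow> bool" where
  "dual_nonneg p \<longleftrightarrow> (\<forall>\<alpha>. 0 \<le> dual_coord p \<alpha>)"

definition Adm ::
  "(nat \<Rightarrow> (real^'n) set) \<Rightarrow> (nat \<Rightarrow> (real^'d) set)
   \<Rightarrow> (nat \<Rightarrow> (real^'n) \<times> (real^'d) \<Rightarrow> real^'n) \<Rightarrow> real^'n
   \<Rightarrow> ((nat \<Rightarrow> real^'n) \<times> (nat \<Rightarrow> real^'d)) set" where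
  "Adm X U f \<sigma> = {(x, u). (\<forall>t. x t \<in> X t) \<and> (\<forall>t. u t \<in> U t) \<and> x 0 = \<sigma> \<and>
     (\<forall>t. x (Suc t) \<le> f t (x t, u t))}"

definition Dom ::
  "(nat \<Rightarrow> (real^'n) set) \<Rightarrow> (nat \<Rightarrow> (real^'d) set)
   \<Rightarrow> (nat \<Rightarrow> (real^'n) \<times> (real^'d) \<Rightarrow> real^'n) \<Rightarrow> (nat \<Rightarrow> (real^'n) \<times> (real^'d) \<Rightarrow> real) \<Rightarrow> real^'n
   \<Rightarrow> ((nat \<Rightarrow> real^'n) \<times> (nat \<Rightarrow> real^'d)) set" where
  "Dom X U f \<phi> \<sigma> = {(x, u) \<in> Adm X U f \<sigma>. summable (\<lambda>t. \<phi> t (x t, u t))}"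

definition J ::
  "(nat \<Rightarrow> (real^'n) \<times> (real^'d) \<Rightarrow> real) \<Rightarrow> (nat \<Rightarrow> real^'n) \<times> (nat \<Rightarrow> real^'d) \<Rightarrow> real" where
  "J \<phi> = (\<lambda>(x, u). \<Sum>t. \<phi> t (x t, u t))"

text \<open>The difference of the partial sums up to and including time h, in the extended reals so that
  its upper and lower limits always exist.\<close>

definition gap ::
  "(nat \<Rightarrow> (real^'n) \<times> (real^'d) \<Rightarrow> real) \<Rightarrow> (nat \<Rightarrow> real^'n) \<times> (nat \<Rightarrow> real^'d)
   \<Rightarrow> (nat \<Rightarrow> real^'n) \<times> (nat \<Rightarrow> real^'d) \<Rightarrow> nat \<Rightarrow> ereal" where
  "gap \<phi> = (\<lambda>(x', u') (x, u) h.
     ereal ((\<Sum>t=0..h. \<phi> t (x' t, u' t)) - (\<Sum>t=0..h. \<phi> t (x t, u t))))"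

definition solves_P1 where
  "solves_P1 X U f \<phi> \<sigma> z \<longleftrightarrow>
     z \<in> Dom X U f \<phi> \<sigma> \<and> (\<forall>w \<in> Dom X U f \<phi> \<sigma>. J \<phi> w \<le> J \<phi> z)"

definition solves_P2 where
  "solves_P2 X U f \<phi> \<sigma> z \<longleftrightarrow>
     z \<in> Adm X U f \<sigma> \<and> (\<forall>w \<in> Adm X U f \<sigma>. limsup (gap \<phi> z w) \<ge> 0)"

definition solves_P3 where
  "solves_P3 X U f \<phi> \<sigma> z \<longleftrightarrow>
     z \<in> Adm X U f \<sigma> \<and> (\<forall>w \<in> Adm X U f \<sigma>. liminf (gap \<phi> z w) \<ge> 0)"

end

theory Submission
  imports Defs
begin

text \<open>
  Up to a horizon T, an improvement of the process that agrees with the optimal one after T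
  contradicts optimality in each of the three senses. Hence no variation (y, w) with y 0 = 0,
  supported on times up to T, increases the objective to first order while pointing strictly inside
  all active constraints; the inactive ones take care of themselves by lower semicontinuity along
  rays. Gordan's alternative turns this into multipliers up to T.

  By (AE) and the sign condition (v), each coordinate of \<open>p (t + 1)\<close> is controlled by the same
  coordinate of \<open>p t\<close>. So the pair of \<open>\<lambda>\<^sub>0\<close> and \<open>p 1\<close> is nonzero at every horizon and can be
  normalised, and then all \<open>p t\<close> are bounded independently of T. The multipliers up to T therefore
  form a decreasing sequence of nonempty closed subsets of a product that is compact by Tychonoff's
  theorem, and a common element is the multiplier for the infinite horizon.
\<close>

section \<open>Gordan's theorem of the alternative for a subspace\<close>

text \<open>Induction on the coordinates. If no element is positive on \<open>I\<close>, the old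
  weights extend by 0. Otherwise the new coordinate \<open>k\<close> either vanishes on all of
  \<open>S\<close>, and its indicator serves as \<open>m\<close>, or it can be eliminated.\<close>

lemma gordan_subspace:
  fixes S :: "('i \<Rightarrow> real) set"
  assumes "finite I" and "S \<noteq> {}"
    and "\<And>a b r s. r \<in> S \<Longrightarrow> s \<in> S \<Longrightarrow> (\<lambda>i. a * r i + b * s i) \<in> S"
    and "\<not> (\<exists>s\<in>S. \<forall>i\<in>I. 0 < s i)"
  shows "\<exists>m. (\<forall>i\<in>I. 0 \<le> m i) \<and> (\<exists>i\<in>I. m i \<noteq> 0) \<and> (\<forall>s\<in>S. (\<Sum>i\<in>I. m i * s i) = 0)"
  using assms
proof (induction I arbitrary: S rule: finite_induct)
  case empty
  then show ?case by auto
next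
  case (insert k I)
  note lin = insert.prems(2)
  have extend: ?case
    if m: "\<forall>i\<in>I. 0 \<le> m i" "\<exists>i\<in>I. m i \<noteq> 0" "0 \<le> mk"
      "\<And>s. s \<in> S \<Longrightarrow> mk * s k + (\<Sum>i\<in>I. m i * s i) = 0" for m mk
  proof (intro exI[of _ "m(k := mk)"] conjI ballI)
    show "0 \<le> (m(k := mk)) i" if "i \<in> insert k I" for i
      using that m by auto
    show "\<exists>i\<in>insert k I. (m(k := mk)) i \<noteq> 0"
      using m(2) insert.hyps(2) by auto
    show "(\<Sum>i\<in>insert k I. (m(k := mk)) i * s i) = 0" if "s \<in> S" for s
    proof -
      have "(\<Sum>i\<in>I. (m(k := mk)) i * s i) = (\<Sum>i\<in>I. m i * s i)"
        using insert.hyps(2) by (intro sum.cong) auto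
      then show ?thesis using m(4)[OF that] insert.hyps by simp
    qed
  qed
  show ?case
  proof (cases "\<exists>s\<in>S. \<forall>i\<in>I. 0 < s i")
    case False
    then obtain m where "\<forall>i\<in>I. 0 \<le> m i" "\<exists>i\<in>I. m i \<noteq> 0"
      "\<forall>s\<in>S. (\<Sum>i\<in>I. m i * s i) = 0"
      using insert.IH[OF insert.prems(1) lin] by blast
    then show ?thesis by (intro extend[of m 0]) auto
  next
    case True
    then obtain s0 where s0: "s0 \<in> S" "\<And>i. i \<in> I \<Longrightarrow> 0 < s0 i" by blast
    show ?thesis
    proof (cases "\<exists>s\<in>S. s k = 0 \<and> (\<forall>i\<in>I. 0 < s i)")
      case True
      then obtain r where r: "r \<in> S" "r k = 0" "\<And>i. i \<in> I \<Longrightarrow> 0 < r i" by blast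
      have "s k = 0" if s: "s \<in> S" for s
      proof (rule ccontr)
        assume sk: "s k \<noteq> 0"
        \<comment> \<open>\<open>r\<close> vanishes at \<open>k\<close>; adding a small multiple of
          \<open>s\<close>, signed like \<open>s k\<close>, makes coordinate \<open>k\<close>
          positive. A step of length at most \<open>e i\<close> keeps coordinate \<open>i\<close>
          positive; the added 1 avoids division by zero, and the 1 under \<open>Min\<close> below
          covers an empty \<open>I\<close>.\<close>
        define e where "e i = r i / (\<bar>s i\<bar> + 1)" for i
        have epos: "0 < e i" if "i \<in> I" for i
          using r(3)[OF that] by (auto simp: e_def)
        obtain d where d: "0 < d" "\<And>i. i \<in> I \<Longrightarrow> d \<le> e i"
        proof
          show "0 < Min (insert 1 (e ` I))"
            using insert.hyps(1) epos by (subst Min_gr_iff) auto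
          show "Min (insert 1 (e ` I)) \<le> e i" if "i \<in> I" for i
            using insert.hyps(1) that by auto
        qed
        have "0 < r i + d * sgn (s k) * s i" if "i \<in> I" for i
        proof -
          have "\<bar>d * sgn (s k) * s i\<bar> = d * \<bar>s i\<bar>"
            using d(1) sk by (simp add: abs_mult)
          also have "\<dots> < d * (\<bar>s i\<bar> + 1)" using d(1) by simp
          also have "\<dots> \<le> e i * (\<bar>s i\<bar> + 1)" using d(2)[OF that] by (intro mult_right_mono) auto
          also have "\<dots> = r i" by (simp add: e_def)
          finally show ?thesis by linarith
        qed
        moreover have "0 < r k + d * sgn (s k) * s k"
          using r(2) d(1) sk by (auto simp: sgn_if intro: mult_pos_neg)
        moreover have "(\<lambda>i. r i + d * sgn (s k) * s i) \<in> S"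
          using lin[OF r(1) s, of 1 "d * sgn (s k)"] by simp
        ultimately show False using insert.prems(3) by fastforce
      qed
      then have "(\<Sum>i\<in>insert k I. of_bool (i = k) * s i) = 0" if "s \<in> S" for s
        using that by (intro sum.neutral) auto
      then show ?thesis
        by (intro exI[of _ "\<lambda>i. of_bool (i = k)"]) auto
    next
      case False
      have s0k: "s0 k < 0"
        using s0 False insert.prems(3) by (metis insert_iff linorder_neqE_linordered_idom)
      \<comment> \<open>Eliminate the coordinate k by projecting S along s0 onto its kernel.\<close>
      define S' where "S' = {s \<in> S. s k = 0}"
      have "\<exists>m. (\<forall>i\<in>I. 0 \<le> m i) \<and> (\<exists>i\<in>I. m i \<noteq> 0) \<and> (\<forall>s\<in>S'. (\<Sum>i\<in>I. m i * s i) = 0)"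
      proof (rule insert.IH)
        show "S' \<noteq> {}"
          using lin[OF s0(1) s0(1), of 0 0] by (auto simp: S'_def)
        show "(\<lambda>i. a * r i + b * s i) \<in> S'" if "r \<in> S'" "s \<in> S'" for a b r s
          using that lin by (auto simp: S'_def)
        show "\<not> (\<exists>s\<in>S'. \<forall>i\<in>I. 0 < s i)"
          using False by (auto simp: S'_def)
      qed
      then obtain m where m: "\<forall>i\<in>I. 0 \<le> m i" "\<exists>i\<in>I. m i \<noteq> 0"
        "\<And>s. s \<in> S' \<Longrightarrow> (\<Sum>i\<in>I. m i * s i) = 0" by blast
      show ?thesis
      proof (rule extend[OF m(1,2)])
        \<comment> \<open>The weight of \<open>k\<close> is the one that makes the relation hold at
          \<open>s0\<close>; its sign is right because \<open>s0\<close> is positive on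
          \<open>I\<close> and negative at \<open>k\<close>.\<close>
        show "0 \<le> (\<Sum>i\<in>I. m i * s0 i) / (- s0 k)"
          using m(1) s0(2) s0k by (intro divide_nonneg_pos sum_nonneg mult_nonneg_nonneg) (auto intro: less_imp_le)
        show "(\<Sum>i\<in>I. m i * s0 i) / (- s0 k) * s k + (\<Sum>i\<in>I. m i * s i) = 0" if "s \<in> S" for s
        proof -
          have "(\<lambda>i. 1 * s i + (- s k / s0 k) * s0 i) \<in> S'"
            using lin[OF that s0(1), of 1 "- s k / s0 k"] s0k
            unfolding S'_def by (intro CollectI conjI) (assumption | simp)+
          from m(3)[OF this] have "(\<Sum>i\<in>I. m i * s i) + (- s k / s0 k) * (\<Sum>i\<in>I. m i * s0 i) = 0"
            by (simp add: algebra_simps sum.distrib sum_distrib_left sum_divide_distrib sum_subtractf sum_negf)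
          then show ?thesis using s0k by (simp add: field_simps)
        qed
      qed
    qed
  qed
qed

subsection \<open>Gateaux derivatives along rays\<close>

lemma tendsto_along_ray:
  fixes a v :: "'a::real_normed_vector"
  shows "((\<lambda>s. a + s *\<^sub>R v) \<longlongrightarrow> a) (at_right 0)"
proof -
  have "((\<lambda>s. a + s *\<^sub>R v) \<longlongrightarrow> a + 0 *\<^sub>R v) (at_right (0::real))"
    by (intro tendsto_intros)
  then show ?thesis by simp
qed

lemma eventually_in_along_ray:
  fixes a v :: "'a::real_normed_vector"
  assumes "a \<in> interior A"
  shows "\<forall>\<^sub>F s in at_right 0. a + s *\<^sub>R v \<in> A"
proof -
  have "\<forall>\<^sub>F s in at_right 0. a + s *\<^sub>R v \<in> interior A"
    using assms by (intro topological_tendstoD[OF tendsto_along_ray]) auto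
  then show ?thesis
    by eventually_elim (use interior_subset in auto)
qed

text \<open>At an interior point the s with a + s v in \<open>A\<close> form a neighbourhood of 0,
  so the restricted limit is two-sided. Its right half suffices, since variations are followed with
  s > 0.\<close>

lemma gateaux_quotient_tendsto:
  fixes \<Phi> :: "'a::real_normed_vector \<Rightarrow> 'b::real_normed_vector"
  assumes "gateaux_differentiable A \<Phi> a" and "a \<in> interior A"
  shows "(gateaux_quotient \<Phi> a v \<longlongrightarrow> gateaux_deriv A \<Phi> a v) (at_right 0)"
proof -
  let ?R = "{s. a + s *\<^sub>R v \<in> A}"
  have "open ((\<lambda>s. a + s *\<^sub>R v) -` interior A)"
    by (intro open_vimage continuous_intros) auto
  moreover have "0 \<in> (\<lambda>s. a + s *\<^sub>R v) -` interior A" using assms(2) by auto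
  moreover have "(\<lambda>s. a + s *\<^sub>R v) -` interior A \<subseteq> ?R"
    using interior_subset by auto
  ultimately have "0 \<in> interior ?R" by (meson interiorI)
  then have at: "at 0 within ?R = at 0" by (rule at_within_interior)
  obtain l where l: "(gateaux_quotient \<Phi> a v \<longlongrightarrow> l) (at 0)"
    using assms(1) at unfolding gateaux_differentiable_def by metis
  moreover have "gateaux_deriv A \<Phi> a v = l"
    unfolding gateaux_deriv_def at using l by (intro tendsto_Lim) auto
  ultimately show ?thesis
    by (metis at_le tendsto_mono top_greatest)
qed

lemma linear_gateaux_deriv:
  "gateaux_differentiable A \<Phi> a \<Longrightarrow> linear (gateaux_deriv A \<Phi> a)"
  by (simp add: gateaux_differentiable_def)

text \<open>Both sides are limits of the same quotient over the same set of s.\<close>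

lemma gateaux_deriv1_eq: "gateaux_deriv1 A \<Phi> a v = gateaux_deriv A \<Phi> a (v, 0)"
  by (cases a) (simp add: gateaux_deriv1_def gateaux_deriv_def gateaux_quotient_def[abs_def])

lemma gateaux_deriv2_eq: "gateaux_deriv2 A \<Phi> a v = gateaux_deriv A \<Phi> a (0, v)"
  by (cases a) (simp add: gateaux_deriv2_def gateaux_deriv_def gateaux_quotient_def[abs_def])

text \<open>Semicontinuity is phrased for points other than \<open>a\<close>, while the ray stays at
  \<open>a\<close> if \<open>v = 0\<close>; there \<open>y < g a\<close> takes over.\<close>

lemma eventually_gt_along_ray:
  fixes g :: "'a::real_normed_vector \<Rightarrow> real"
  assumes "lsc_at A g a" and "a \<in> interior A" and "y < g a"
  shows "\<forall>\<^sub>F s in at_right 0. y < g (a + s *\<^sub>R v)"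
proof -
  have "\<forall>\<^sub>F z in nhds a. z \<noteq> a \<longrightarrow> z \<in> A \<longrightarrow> y < g z"
    using assms(1,3) by (auto simp: lsc_at_def eventually_at_filter)
  then have "\<forall>\<^sub>F s in at_right 0. a + s *\<^sub>R v \<noteq> a \<longrightarrow> a + s *\<^sub>R v \<in> A \<longrightarrow> y < g (a + s *\<^sub>R v)"
    by (rule eventually_compose_filterlim[OF _ tendsto_along_ray])
  then show ?thesis
    using eventually_in_along_ray[OF assms(2)]
    by eventually_elim (use assms(3) in auto)
qed

subsection \<open>First-order optimality up to a finite horizon\<close>

text \<open>The gap is constant from \<open>T\<close> on, so its upper and lower limits are both the
  finite sum. For the first problem, the common tail makes the competitor's series converge, which
  puts it in \<open>Dom\<close>.\<close>

lemma truncated_optimality: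
  assumes j: "j \<in> {1, 2, 3}"
    and sol: "j = 1 \<Longrightarrow> solves_P1 X U f \<phi> \<sigma> (xh, uh)"
             "j = 2 \<Longrightarrow> solves_P2 X U f \<phi> \<sigma> (xh, uh)"
             "j = (3::nat) \<Longrightarrow> solves_P3 X U f \<phi> \<sigma> (xh, uh)"
    and adm: "(x, u) \<in> Adm X U f \<sigma>"
    and tail: "\<And>t. t > T \<Longrightarrow> x t = xh t \<and> u t = uh t"
  shows "(\<Sum>t\<le>T. \<phi> t (x t, u t)) \<le> (\<Sum>t\<le>T. \<phi> t (xh t, uh t))"
proof -
  let ?d = "\<lambda>t. \<phi> t (xh t, uh t) - \<phi> t (x t, u t)"
  have d0: "?d t = 0" if "t > T" for t using tail[OF that] by simp
  have "gap \<phi> (xh, uh) (x, u) h = ereal (\<Sum>t\<le>T. ?d t)" if "h \<ge> T" for h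
  proof -
    have "(\<Sum>t=0..h. ?d t) = (\<Sum>t\<le>T. ?d t)"
      using that d0 by (intro sum.mono_neutral_right) auto
    then show ?thesis by (simp add: gap_def sum_subtractf)
  qed
  then have "gap \<phi> (xh, uh) (x, u) \<longlonglongrightarrow> ereal (\<Sum>t\<le>T. ?d t)"
    by (intro tendsto_eventually) (auto simp: eventually_sequentially)
  then have lims: "limsup (gap \<phi> (xh, uh) (x, u)) = ereal (\<Sum>t\<le>T. ?d t)"
     "liminf (gap \<phi> (xh, uh) (x, u)) = ereal (\<Sum>t\<le>T. ?d t)"
    by (auto intro: lim_imp_Limsup lim_imp_Liminf)
  have "0 \<le> (\<Sum>t\<le>T. ?d t)"
  proof -
    consider "j = 1" | "j = 2" | "j = 3" using j by auto
    then show ?thesis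
    proof cases
      case 1
      note s = sol(1)[OF 1]
      have sh: "summable (\<lambda>t. \<phi> t (xh t, uh t))"
        using s by (auto simp: solves_P1_def Dom_def)
      have d: "?d sums (\<Sum>t\<le>T. ?d t)"
        by (rule sums_finite) (use d0 in \<open>auto simp: not_le\<close>)
      have "(\<lambda>t. \<phi> t (xh t, uh t) - ?d t) sums ((\<Sum>t. \<phi> t (xh t, uh t)) - (\<Sum>t\<le>T. ?d t))"
        by (intro sums_diff d summable_sums sh)
      then have x: "(\<lambda>t. \<phi> t (x t, u t)) sums ((\<Sum>t. \<phi> t (xh t, uh t)) - (\<Sum>t\<le>T. ?d t))"
        by simp
      then have "(x, u) \<in> Dom X U f \<phi> \<sigma>"
        using adm by (auto simp: Dom_def sums_iff)
      then have "J \<phi> (x, u) \<le> J \<phi> (xh, uh)" using s by (auto simp: solves_P1_def)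
      then show ?thesis using sums_unique[OF x] by (simp add: J_def)
    next
      case 2
      then show ?thesis using sol(2) adm lims by (fastforce simp: solves_P2_def)
    next
      case 3
      then show ?thesis using sol(3) adm lims by (fastforce simp: solves_P3_def)
    qed
  qed
  then show ?thesis by (simp add: sum_subtractf)
qed

text \<open>Were the first-order gain positive, a small step along the variation would yield a
  better admissible process with the same tail: only finitely many conditions up to \<open>T\<close>
  have to hold for small s.\<close>

lemma no_improving_direction:
  fixes X :: "nat \<Rightarrow> (real^'n) set"
    and U :: "nat \<Rightarrow> (real^'d) set"
    and f :: "nat \<Rightarrow> (real^'n) \<times> (real^'d) \<Rightarrow> real^'n"
    and \<phi> :: "nat \<Rightarrow> (real^'n) \<times> (real^'d) \<Rightarrow> real"
  assumes X: "\<And>t. open (X t)"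
    and adm: "(xh, uh) \<in> Adm X U f \<sigma>"
    and opt: "\<And>x u. (x, u) \<in> Adm X U f \<sigma> \<Longrightarrow> (\<And>t. t > T \<Longrightarrow> x t = xh t \<and> u t = uh t)
      \<Longrightarrow> (\<Sum>t\<le>T. \<phi> t (x t, u t)) \<le> (\<Sum>t\<le>T. \<phi> t (xh t, uh t))"
    and uh: "\<And>t. uh t \<in> interior (U t)"
    and gd: "\<And>t. gateaux_differentiable (X t \<times> U t) (\<phi> t) (xh t, uh t)"
            "\<And>t. gateaux_differentiable (X t \<times> U t) (f t) (xh t, uh t)"
    and lsc: "\<And>t \<alpha>. f t (xh t, uh t) $ \<alpha> > xh (Suc t) $ \<alpha> \<Longrightarrow>
                lsc_at (X t \<times> U t) (\<lambda>z. f t z $ \<alpha>) (xh t, uh t)"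
    and y0: "y 0 = 0" and tail: "\<And>t. t > T \<Longrightarrow> y t = 0 \<and> w t = 0"
    and active: "\<And>t \<alpha>. t \<le> T \<Longrightarrow> f t (xh t, uh t) $ \<alpha> = xh (Suc t) $ \<alpha> \<Longrightarrow>
       y (Suc t) $ \<alpha> < gateaux_deriv (X t \<times> U t) (f t) (xh t, uh t) (y t, w t) $ \<alpha>"
  shows "(\<Sum>t\<le>T. gateaux_deriv (X t \<times> U t) (\<phi> t) (xh t, uh t) (y t, w t)) \<le> 0"
proof (rule ccontr)
  assume neg: "\<not> ?thesis"
  let ?A = "\<lambda>t. X t \<times> U t" and ?a = "\<lambda>t. (xh t, uh t)" and ?v = "\<lambda>t. (y t, w t)"
  have xhX: "xh t \<in> X t" and uhU: "uh t \<in> U t" and xh0: "xh 0 = \<sigma>"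
    and dyn: "xh (Suc t) \<le> f t (?a t)" for t
    using adm by (auto simp: Adm_def)
  have int: "?a t \<in> interior (?A t)" for t
    using X xhX uh by (simp add: interior_Times interior_open)
  have pos: "\<forall>\<^sub>F s in at_right (0::real). 0 < s"
    by (rule eventually_at_right_less)
  have "((\<lambda>s. \<Sum>t\<le>T. gateaux_quotient (\<phi> t) (?a t) (?v t) s) \<longlongrightarrow>
      (\<Sum>t\<le>T. gateaux_deriv (?A t) (\<phi> t) (?a t) (?v t))) (at_right 0)"
    by (intro tendsto_sum gateaux_quotient_tendsto gd int)
  then have "\<forall>\<^sub>F s in at_right 0. 0 < (\<Sum>t\<le>T. gateaux_quotient (\<phi> t) (?a t) (?v t) s)"
    using neg by (intro order_tendstoD(1)) auto
  then have ev_gain: "\<forall>\<^sub>F s in at_right 0. (\<Sum>t\<le>T. \<phi> t (?a t)) < (\<Sum>t\<le>T. \<phi> t (?a t + s *\<^sub>R ?v t))"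
    using pos
  proof eventually_elim
    case (elim s)
    have "(\<Sum>t\<le>T. gateaux_quotient (\<phi> t) (?a t) (?v t) s)
        = (1 / s) * ((\<Sum>t\<le>T. \<phi> t (?a t + s *\<^sub>R ?v t)) - (\<Sum>t\<le>T. \<phi> t (?a t)))"
      by (simp add: gateaux_quotient_def sum_subtractf sum_distrib_left flip: sum_divide_distrib)
    with elim show ?case by (simp add: zero_less_divide_iff)
  qed
  \<comment> \<open>At an active coordinate both sides agree at s = 0 and the slopes decide. At an
    inactive one, a value \<open>r\<close> inside the slack separates the left side, by continuity,
    from the right side, by lower semicontinuity.\<close>
  have ev_dyn: "\<forall>\<^sub>F s in at_right 0. xh (Suc t) $ \<alpha> + s * y (Suc t) $ \<alpha> < f t (?a t + s *\<^sub>R ?v t) $ \<alpha>"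
    if t: "t \<le> T" for t \<alpha>
  proof (cases "f t (?a t) $ \<alpha> = xh (Suc t) $ \<alpha>")
    case True
    have "((\<lambda>s. gateaux_quotient (f t) (?a t) (?v t) s $ \<alpha>) \<longlongrightarrow>
        gateaux_deriv (?A t) (f t) (?a t) (?v t) $ \<alpha>) (at_right 0)"
      by (intro tendsto_vec_nth gateaux_quotient_tendsto gd int)
    then have "\<forall>\<^sub>F s in at_right 0. y (Suc t) $ \<alpha> < gateaux_quotient (f t) (?a t) (?v t) s $ \<alpha>"
      using active[OF t True] by (intro order_tendstoD(1)) auto
    then show ?thesis using pos
      by eventually_elim (use True in \<open>simp add: gateaux_quotient_def field_simps\<close>)
  next
    case False
    then have gt: "xh (Suc t) $ \<alpha> < f t (?a t) $ \<alpha>"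
      using dyn[of t] by (simp add: less_eq_vec_def less_le)
    then obtain r where r: "xh (Suc t) $ \<alpha> < r" "r < f t (?a t) $ \<alpha>" using dense by blast
    have "((\<lambda>s. xh (Suc t) $ \<alpha> + s *\<^sub>R y (Suc t) $ \<alpha>) \<longlongrightarrow> xh (Suc t) $ \<alpha>) (at_right 0)"
      by (rule tendsto_along_ray)
    then have "\<forall>\<^sub>F s in at_right 0. xh (Suc t) $ \<alpha> + s *\<^sub>R y (Suc t) $ \<alpha> < r"
      using r(1) by (intro order_tendstoD(2)) auto
    moreover have "\<forall>\<^sub>F s in at_right 0. r < f t (?a t + s *\<^sub>R ?v t) $ \<alpha>"
      using eventually_gt_along_ray[OF lsc[OF gt] int r(2)] .
    ultimately show ?thesis by eventually_elim simp
  qed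
  have "\<forall>\<^sub>F s in at_right 0. (\<Sum>t\<le>T. \<phi> t (?a t)) < (\<Sum>t\<le>T. \<phi> t (?a t + s *\<^sub>R ?v t)) \<and>
      (\<forall>t\<in>{..T}. ?a t + s *\<^sub>R ?v t \<in> ?A t) \<and>
      (\<forall>t\<in>{..T}. \<forall>\<alpha>\<in>UNIV. xh (Suc t) $ \<alpha> + s * y (Suc t) $ \<alpha> < f t (?a t + s *\<^sub>R ?v t) $ \<alpha>)"
    by (intro eventually_conj eventually_ball_finite ballI finite_atMost finite
        ev_gain ev_dyn eventually_in_along_ray int) auto
  then obtain s where s: "(\<Sum>t\<le>T. \<phi> t (?a t)) < (\<Sum>t\<le>T. \<phi> t (?a t + s *\<^sub>R ?v t))"
    "\<And>t. t \<le> T \<Longrightarrow> ?a t + s *\<^sub>R ?v t \<in> ?A t"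
    "\<And>t \<alpha>. t \<le> T \<Longrightarrow> xh (Suc t) $ \<alpha> + s * y (Suc t) $ \<alpha> < f t (?a t + s *\<^sub>R ?v t) $ \<alpha>"
    by (auto dest!: eventually_happens)
  let ?x = "\<lambda>t. xh t + s *\<^sub>R y t" and ?u = "\<lambda>t. uh t + s *\<^sub>R w t"
  have "(?x, ?u) \<in> Adm X U f \<sigma>"
  proof -
    have "?x t \<in> X t \<and> ?u t \<in> U t \<and> ?x (Suc t) \<le> f t (?x t, ?u t)" for t
    proof (cases "t \<le> T")
      case True
      then show ?thesis using s(2,3)[OF True] by (auto simp: less_eq_vec_def less_imp_le)
    next
      case False
      \<comment> \<open>Past \<open>T\<close> both \<open>y t\<close> and \<open>y (Suc t)\<close>
        vanish, so nothing moves. The constraint at \<open>T\<close> itself falls under the first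
        case, with \<open>y (Suc T) = 0\<close>.\<close>
      then show ?thesis using tail[of t] tail[of "Suc t"] xhX uhU dyn by simp
    qed
    then show ?thesis using y0 xh0 by (simp add: Adm_def)
  qed
  then have "(\<Sum>t\<le>T. \<phi> t (?x t, ?u t)) \<le> (\<Sum>t\<le>T. \<phi> t (?a t))"
    using tail by (intro opt) auto
  with s(1) show False by simp
qed

subsection \<open>Multipliers\<close>

text \<open>The vector \<open>q t\<close> represents the functional \<open>p t\<close> through the inner product; \<open>act t\<close> is the set of
  active coordinates, and A, c are the differentials of the dynamics and of the payoff.\<close>

definition multiplier ::
  "(nat \<Rightarrow> (real^'n) \<times> 'd::real_normed_vector \<Rightarrow> real^'n) \<Rightarrow> (nat \<Rightarrow> (real^'n) \<times> 'd \<Rightarrow> real)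
   \<Rightarrow> (nat \<Rightarrow> 'n set) \<Rightarrow> nat \<Rightarrow> real \<Rightarrow> (nat \<Rightarrow> real^'n) \<Rightarrow> bool" where
  "multiplier A c act t l q \<longleftrightarrow>
     (\<forall>\<alpha>. \<alpha> \<notin> act t \<longrightarrow> q (Suc t) $ \<alpha> = 0) \<and>
     (\<forall>w. q (Suc t) \<bullet> A t (0, w) + l * c t (0, w) = 0) \<and>
     (t \<ge> 1 \<longrightarrow> (\<forall>v. q t \<bullet> v = q (Suc t) \<bullet> A t (v, 0) + l * c t (v, 0)))"

text \<open>Gordan's alternative for the vectors made of the first-order gain (index
  \<open>None\<close>) and the linearised slacks of the active constraints. Variations concentrated
  at one time then split the single relation into one multiplier condition per time.\<close>

lemma finite_horizon_multipliers:
  fixes A :: "nat \<Rightarrow> (real^'n) \<times> 'd::real_normed_vector \<Rightarrow> real^'n"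
  assumes A: "\<And>t. linear (A t)" and c: "\<And>t. linear (c t)"
    and no_improvement: "\<And>y w. y 0 = 0 \<Longrightarrow> (\<And>t. t > T \<Longrightarrow> y t = 0 \<and> w t = 0) \<Longrightarrow>
      (\<And>t \<alpha>. t \<le> T \<Longrightarrow> \<alpha> \<in> act t \<Longrightarrow> y (Suc t) $ \<alpha> < A t (y t, w t) $ \<alpha>) \<Longrightarrow>
      (\<Sum>t\<le>T. c t (y t, w t)) \<le> 0"
  obtains l q where "0 \<le> l" "\<And>t. 0 \<le> q t" "\<And>t. t \<le> T \<Longrightarrow> multiplier A c act t l q"
    "l \<noteq> 0 \<or> (\<exists>t\<le>T. q (Suc t) \<noteq> 0)"
proof -
  define var where "var = {(y, w). y 0 = (0::real^'n) \<and> (\<forall>t>T. y t = 0 \<and> w t = (0::'d))}"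
  define val where "val = (\<lambda>(y, w) i. case i of None \<Rightarrow> (\<Sum>t\<le>T. c t (y t, w t))
    | Some (t, \<alpha>) \<Rightarrow> A t (y t, w t) $ \<alpha> - y (Suc t) $ \<alpha>)"
  define P where "P = (SIGMA t:{..T}. act t)"
  have [simp]: "finite P" by (simp add: P_def)
  have "\<exists>m. (\<forall>i\<in>insert None (Some ` P). 0 \<le> m i) \<and> (\<exists>i\<in>insert None (Some ` P). m i \<noteq> 0) \<and>
    (\<forall>s\<in>val ` var. (\<Sum>i\<in>insert None (Some ` P). m i * s i) = 0)"
  proof (rule gordan_subspace)
    show "val ` var \<noteq> {}" by (auto simp: var_def)
    show "(\<lambda>i. a * r i + b * s i) \<in> val ` var"
      if rs: "r \<in> val ` var" "s \<in> val ` var" for a b r s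
    proof -
      obtain y w y' w' where e: "(y, w) \<in> var" "r = val (y, w)" "(y', w') \<in> var" "s = val (y', w')"
        using rs by auto
      let ?y = "\<lambda>t. a *\<^sub>R y t + b *\<^sub>R y' t" and ?w = "\<lambda>t. a *\<^sub>R w t + b *\<^sub>R w' t"
      have pair: "(?y t, ?w t) = a *\<^sub>R (y t, w t) + b *\<^sub>R (y' t, w' t)" for t by simp
      have "(?y, ?w) \<in> var" using e by (auto simp: var_def)
      moreover have "(\<lambda>i. a * r i + b * s i) = val (?y, ?w)"
        unfolding e val_def prod.case pair
        by (rule ext, simp only: linear_add[OF A] linear_add[OF c] linear_scale[OF A] linear_scale[OF c])
          (auto split: option.split simp: sum.distrib sum_distrib_left algebra_simps)
      ultimately show ?thesis by blast
    qed
    show "\<not> (\<exists>s\<in>val ` var. \<forall>i\<in>insert None (Some ` P). 0 < s i)"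
    proof
      assume "\<exists>s\<in>val ` var. \<forall>i\<in>insert None (Some ` P). 0 < s i"
      then obtain y w where yw: "(y, w) \<in> var" "\<forall>i\<in>insert None (Some ` P). 0 < val (y, w) i" by auto
      have "(\<Sum>t\<le>T. c t (y t, w t)) \<le> 0"
        using yw by (intro no_improvement) (auto simp: var_def val_def P_def)
      then show False using yw by (auto simp: val_def)
    qed
  qed auto
  then obtain m where m: "\<forall>i\<in>insert None (Some ` P). 0 \<le> m i" "\<exists>i\<in>insert None (Some ` P). m i \<noteq> 0"
    "\<And>y w. (y, w) \<in> var \<Longrightarrow> (\<Sum>i\<in>insert None (Some ` P). m i * val (y, w) i) = 0"
    by auto
  define l where "l = m None"
  \<comment> \<open>Index shift: the weight of the constraint on \<open>y (Suc t)\<close> goes into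
    \<open>q (Suc t)\<close>. The value 0 off \<open>P\<close> gives complementary slackness and
    turns sums over \<open>P\<close> into inner products.\<close>
  define q where "q t = (\<chi> \<alpha>. if 1 \<le> t \<and> (t - 1, \<alpha>) \<in> P then m (Some (t - 1, \<alpha>)) else 0)" for t
  have stat: "l * (\<Sum>t\<le>T. c t (y t, w t)) + (\<Sum>t\<le>T. q (Suc t) \<bullet> (A t (y t, w t) - y (Suc t))) = 0"
    if "(y, w) \<in> var" for y w
  proof -
    have "(\<Sum>t\<le>T. q (Suc t) \<bullet> (A t (y t, w t) - y (Suc t)))
      = (\<Sum>(t, \<alpha>)\<in>{..T} \<times> UNIV. q (Suc t) $ \<alpha> * (A t (y t, w t) - y (Suc t)) $ \<alpha>)"
      by (simp add: inner_vec_def sum.cartesian_product)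
    also have "\<dots> = (\<Sum>(t, \<alpha>)\<in>P. q (Suc t) $ \<alpha> * (A t (y t, w t) - y (Suc t)) $ \<alpha>)"
      by (intro sum.mono_neutral_right) (auto simp: P_def q_def split: if_splits)
    also have "\<dots> = (\<Sum>p\<in>P. m (Some p) * val (y, w) (Some p))"
      by (intro sum.cong) (auto simp: val_def q_def)
    also have "\<dots> = (\<Sum>i\<in>Some ` P. m i * val (y, w) i)"
      by (simp add: sum.reindex)
    finally show ?thesis using m(3)[OF that]
      by (simp add: l_def val_def image_iff)
  qed
  have "multiplier A c act t l q" if t: "t \<le> T" for t
    unfolding multiplier_def
  proof (intro conjI allI impI)
    show "q (Suc t) $ \<alpha> = 0" if "\<alpha> \<notin> act t" for \<alpha>
      using that by (simp add: q_def P_def)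
    show "q (Suc t) \<bullet> A t (0, w) + l * c t (0, w) = 0" for w
    proof -
      \<comment> \<open>Moving only the control at time \<open>t\<close> leaves one term of each sum
        in \<open>stat\<close>.\<close>
      let ?w = "\<lambda>s. if s = t then w else 0"
      have "(\<Sum>s\<le>T. c s (0, ?w s)) = (\<Sum>s\<le>T. if s = t then c t (0, w) else 0)"
        by (intro sum.cong) (auto simp: linear_0[OF c] simp flip: zero_prod_def)
      moreover have "(\<Sum>s\<le>T. q (Suc s) \<bullet> (A s (0, ?w s) - 0))
          = (\<Sum>s\<le>T. if s = t then q (Suc t) \<bullet> A t (0, w) else 0)"
        by (intro sum.cong) (auto simp: linear_0[OF A] simp flip: zero_prod_def)
      ultimately show ?thesis
        using stat[of "\<lambda>_. 0" ?w] t by (simp add: var_def)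
    qed
    show "q t \<bullet> v = q (Suc t) \<bullet> A t (v, 0) + l * c t (v, 0)" if "1 \<le> t" for v
    proof -
      \<comment> \<open>Moving only the state at time \<open>t\<close> enters twice: in the dynamics
        at \<open>t\<close>, and as the left side of the constraint at \<open>k\<close>.\<close>
      obtain k where k: "t = Suc k" using \<open>1 \<le> t\<close> by (cases t) auto
      let ?y = "\<lambda>s. if s = t then v else 0"
      have "(\<Sum>s\<le>T. c s (?y s, 0)) = (\<Sum>s\<le>T. if s = t then c t (v, 0) else 0)"
        by (intro sum.cong) (auto simp: linear_0[OF c] simp flip: zero_prod_def)
      moreover have "(\<Sum>s\<le>T. q (Suc s) \<bullet> (A s (?y s, 0) - ?y (Suc s)))
          = (\<Sum>s\<le>T. (if s = t then q (Suc t) \<bullet> A t (v, 0) else 0) - (if s = k then q t \<bullet> v else 0))"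
        by (intro sum.cong) (auto simp: k linear_0[OF A] simp flip: zero_prod_def)
      ultimately show ?thesis
        using stat[of ?y "\<lambda>_. 0"] t by (simp add: var_def sum_subtractf k)
    qed
  qed
  moreover have "0 \<le> l" using m(1) by (simp add: l_def)
  moreover have "0 \<le> q t" for t using m(1) by (auto simp: less_eq_vec_def q_def)
  moreover have "l \<noteq> 0 \<or> (\<exists>t\<le>T. q (Suc t) \<noteq> 0)"
  proof (rule disjCI)
    assume zero: "\<not> (\<exists>t\<le>T. q (Suc t) \<noteq> 0)"
    have "m (Some (t, \<alpha>)) = 0" if "(t, \<alpha>) \<in> P" for t \<alpha>
    proof -
      have "q (Suc t) = 0" using zero that by (simp add: P_def)
      then have "q (Suc t) $ \<alpha> = 0" by simp
      then show ?thesis using that by (simp add: q_def)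
    qed
    then show "l \<noteq> 0" using m(2) by (auto simp: l_def)
  qed
  ultimately show ?thesis by (intro that) auto
qed

section \<open>Propagation of bounds forward in time by the sign condition\<close>

text \<open>The adjoint equation on the basis vector \<open>axis \<alpha> 1\<close>, with the
  nonnegative off-diagonal terms dropped.\<close>

lemma multiplier_lower_bound:
  assumes "multiplier A c act t l q" and "1 \<le> t" and q: "0 \<le> q (Suc t)"
    and pos: "\<And>\<alpha> \<beta>. 0 \<le> A t (axis \<beta> 1, 0) $ \<alpha>"
  shows "q (Suc t) $ \<alpha> * A t (axis \<alpha> 1, 0) $ \<alpha> + l * c t (axis \<alpha> 1, 0) \<le> q t $ \<alpha>"
proof -
  have "q (Suc t) $ \<alpha> * A t (axis \<alpha> 1, 0) $ \<alpha> \<le> (\<Sum>\<beta>\<in>UNIV. q (Suc t) $ \<beta> * A t (axis \<alpha> 1, 0) $ \<beta>)"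
    using q pos by (intro member_le_sum) (auto simp: less_eq_vec_def)
  also have "\<dots> = q (Suc t) \<bullet> A t (axis \<alpha> 1, 0)" by (simp add: inner_vec_def)
  also have "\<dots> + l * c t (axis \<alpha> 1, 0) = q t $ \<alpha>"
    using assms(1,2) by (simp add: multiplier_def inner_axis) (metis inner_axis inner_real_def mult.right_neutral)
  finally show ?thesis by simp
qed

lemma multiplier_scale:
  "multiplier A c act t l q \<Longrightarrow> multiplier A c act t (k * l) (\<lambda>s. k *\<^sub>R q s)"
  unfolding multiplier_def by (auto simp: mult.assoc simp flip: distrib_left)

text \<open>With \<open>l = 0\<close> the lower bound carries zero forward: a nonnegative coordinate
  times a positive diagonal entry is at most 0.\<close>

lemma multiplier_vanishes:
  assumes mult: "\<And>t. t \<le> T \<Longrightarrow> multiplier A c act t 0 q"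
    and nonneg: "\<And>t. 0 \<le> q t"
    and pos: "\<And>t \<alpha> \<beta>. 1 \<le> t \<Longrightarrow> 0 \<le> A t (axis \<beta> 1, 0) $ \<alpha>"
             "\<And>t \<alpha>. 1 \<le> t \<Longrightarrow> 0 < A t (axis \<alpha> 1, 0) $ \<alpha>"
    and q1: "q 1 = 0" and "t \<le> T"
  shows "q (Suc t) = 0"
  using \<open>t \<le> T\<close>
proof (induction t)
  case 0
  then show ?case using q1 by simp
next
  case (Suc t)
  have "q (Suc (Suc t)) $ \<alpha> = 0" for \<alpha>
  proof -
    have "q (Suc (Suc t)) $ \<alpha> * A (Suc t) (axis \<alpha> 1, 0) $ \<alpha> \<le> 0"
      using multiplier_lower_bound[OF mult[OF Suc.prems] _ nonneg pos(1), of \<alpha>] Suc by simp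
    moreover have "0 \<le> q (Suc (Suc t)) $ \<alpha>" using nonneg by (simp add: less_eq_vec_def)
    ultimately show ?thesis using pos(2)[of "Suc t" \<alpha>] by (simp add: mult_le_0_iff)
  qed
  then show ?case by (simp add: vec_eq_iff)
qed

text \<open>The bound is chosen before \<open>l\<close> and \<open>q\<close>, so for given
  \<open>t\<close> it serves all horizons from \<open>t\<close> on at once, as compactness
  requires.\<close>

lemma multiplier_bounded:
  fixes A :: "nat \<Rightarrow> (real^'n) \<times> 'd::real_normed_vector \<Rightarrow> real^'n"
  assumes pos: "\<And>t \<alpha> \<beta>. 1 \<le> t \<Longrightarrow> 0 \<le> A t (axis \<beta> 1, 0) $ \<alpha>"
             "\<And>t \<alpha>. 1 \<le> t \<Longrightarrow> 0 < A t (axis \<alpha> 1, 0) $ \<alpha>"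
  shows "\<exists>b. \<forall>l q. (\<forall>s\<le>t. multiplier A c act s l q) \<longrightarrow> (\<forall>s. 0 \<le> q s) \<longrightarrow> 0 \<le> l \<longrightarrow>
           l + (\<Sum>\<alpha>\<in>UNIV. q 1 $ \<alpha>) = 1 \<longrightarrow> q (Suc t) \<le> b"
proof (induction t)
  case 0
  have "q 1 \<le> 1" if "\<forall>s. 0 \<le> q s" "0 \<le> l" "l + (\<Sum>\<alpha>\<in>UNIV. q 1 $ \<alpha>) = 1"
    for l and q :: "nat \<Rightarrow> real^'n"
  proof -
    have "q 1 $ \<alpha> \<le> (\<Sum>\<alpha>\<in>UNIV. q 1 $ \<alpha>)" for \<alpha>
      using that(1) by (intro member_le_sum) (auto simp: less_eq_vec_def)
    then show ?thesis using that(2,3) by (simp add: less_eq_vec_def) (smt (verit))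
  qed
  then show ?case by auto
next
  case (Suc t)
  then obtain b where b: "\<And>l q. \<lbrakk>\<forall>s\<le>t. multiplier A c act s l q; \<forall>s. 0 \<le> q s; 0 \<le> l;
      l + (\<Sum>\<alpha>\<in>UNIV. q 1 $ \<alpha>) = 1\<rbrakk> \<Longrightarrow> q (Suc t) \<le> b" by blast
  define a where "a \<alpha> = (axis \<alpha> 1 :: real^'n, 0 :: 'd)" for \<alpha>
  \<comment> \<open>\<open>multiplier_lower_bound\<close> divided by the diagonal entry; the
    normalisation gives |l| <= 1, which removes \<open>l\<close> from the bound.\<close>
  have "q (Suc (Suc t)) \<le> (\<chi> \<alpha>. (b $ \<alpha> + \<bar>c (Suc t) (a \<alpha>)\<bar>) / A (Suc t) (a \<alpha>) $ \<alpha>)"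
    if h: "\<forall>s\<le>Suc t. multiplier A c act s l q" "\<forall>s. 0 \<le> q s" "0 \<le> l"
      "l + (\<Sum>\<alpha>\<in>UNIV. q 1 $ \<alpha>) = 1" for l q
  proof -
    have "0 \<le> (\<Sum>\<alpha>\<in>UNIV. q 1 $ \<alpha>)" using h(2) by (intro sum_nonneg) (auto simp: less_eq_vec_def)
    then have "\<bar>l\<bar> \<le> 1" using h by simp
    have "q (Suc (Suc t)) $ \<alpha> \<le> (b $ \<alpha> + \<bar>c (Suc t) (a \<alpha>)\<bar>) / A (Suc t) (a \<alpha>) $ \<alpha>" for \<alpha>
    proof -
      have "q (Suc (Suc t)) $ \<alpha> * A (Suc t) (a \<alpha>) $ \<alpha> + l * c (Suc t) (a \<alpha>) \<le> q (Suc t) $ \<alpha>"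
        unfolding a_def using h by (intro multiplier_lower_bound pos(1)) auto
      also have "\<dots> \<le> b $ \<alpha>" using b[of l q] h by (simp add: less_eq_vec_def)
      finally have "q (Suc (Suc t)) $ \<alpha> * A (Suc t) (a \<alpha>) $ \<alpha> \<le> b $ \<alpha> - l * c (Suc t) (a \<alpha>)" by simp
      also have "- (l * c (Suc t) (a \<alpha>)) \<le> \<bar>l\<bar> * \<bar>c (Suc t) (a \<alpha>)\<bar>"
        by (metis abs_ge_minus_self abs_mult)
      then have "b $ \<alpha> - l * c (Suc t) (a \<alpha>) \<le> b $ \<alpha> + \<bar>c (Suc t) (a \<alpha>)\<bar>"
        using mult_right_mono[OF \<open>\<bar>l\<bar> \<le> 1\<close>, of "\<bar>c (Suc t) (a \<alpha>)\<bar>"] by simp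
      finally show ?thesis using pos(2)[of "Suc t" \<alpha>] by (simp add: a_def pos_le_divide_eq)
    qed
    then show ?thesis by (simp add: less_eq_vec_def)
  qed
  then show ?case by blast
qed

section \<open>Compactness and passage to the infinite horizon\<close>

lemma continuous_on_snd_coordinate:
  "continuous_on S (\<lambda>z::'a::topological_space \<times> ('i \<Rightarrow> 'b::topological_space). snd z i)"
  by (rule continuous_on_product_then_coordinatewise, rule continuous_on_snd, rule continuous_on_id)

text \<open>In the product topology each clause is a family of equations between continuous
  functions of \<open>l\<close> and finitely many entries of \<open>q\<close>.\<close>

lemma closed_multiplier:
  fixes A :: "nat \<Rightarrow> (real^'n) \<times> 'd::real_normed_vector \<Rightarrow> real^'n"
  shows "closed {(l, q). multiplier A c act t l q}"
proof -
  \<comment> \<open>The premise does not depend on the point, so the implication defines the whole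
    space or the set of its conclusion.\<close>
  have closed_imp: "closed {z. P \<longrightarrow> Q z}" if "P \<Longrightarrow> closed {z. Q z}"
    for P and Q :: "real \<times> (nat \<Rightarrow> real^'n) \<Rightarrow> bool"
    using that by (cases P) auto
  have "closed {z::real \<times> (nat \<Rightarrow> real^'n). (\<forall>\<alpha>. \<alpha> \<notin> act t \<longrightarrow> snd z (Suc t) $ \<alpha> = 0) \<and>
     (\<forall>w. snd z (Suc t) \<bullet> A t (0, w) + fst z * c t (0, w) = 0) \<and>
     (t \<ge> 1 \<longrightarrow> (\<forall>v. snd z t \<bullet> v = snd z (Suc t) \<bullet> A t (v, 0) + fst z * c t (v, 0)))}"
    by (intro closed_Collect_conj closed_Collect_all closed_imp closed_Collect_eq)
      (intro continuous_on_snd_coordinate continuous_on_component continuous_on_inner continuous_on_add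
        continuous_on_mult continuous_on_const continuous_on_fst continuous_on_id)+
  then show ?thesis by (simp add: multiplier_def case_prod_beta')
qed

text \<open>\<open>M T\<close> imposes the condition at time \<open>T\<close> alone, plus the
  normalisation; finitely many of these sets meet inside \<open>K\<close> thanks to a horizon beyond
  all their times.\<close>

lemma infinite_horizon_multipliers:
  fixes A :: "nat \<Rightarrow> (real^'n) \<times> 'd::real_normed_vector \<Rightarrow> real^'n"
  assumes pos: "\<And>t \<alpha> \<beta>. 1 \<le> t \<Longrightarrow> 0 \<le> A t (axis \<beta> 1, 0) $ \<alpha>"
             "\<And>t \<alpha>. 1 \<le> t \<Longrightarrow> 0 < A t (axis \<alpha> 1, 0) $ \<alpha>"
    and fin: "\<And>T. \<exists>l q. 0 \<le> l \<and> (\<forall>t. 0 \<le> q t) \<and> (\<forall>t\<le>T. multiplier A c act t l q) \<and>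
      (l \<noteq> 0 \<or> (\<exists>t\<le>T. q (Suc t) \<noteq> 0))"
  obtains l q where "0 \<le> l" "\<And>t. 0 \<le> q t" "\<And>t. multiplier A c act t l q" "(l, q 1) \<noteq> (0, 0)"
proof -
  have "\<forall>t. \<exists>b. \<forall>l q. (\<forall>s\<le>t. multiplier A c act s l q) \<longrightarrow> (\<forall>s. 0 \<le> q s) \<longrightarrow> 0 \<le> l \<longrightarrow>
      l + (\<Sum>\<alpha>\<in>UNIV. q 1 $ \<alpha>) = 1 \<longrightarrow> q (Suc t) \<le> b"
    by (intro allI multiplier_bounded pos)
  from choice[OF this] obtain b where b: "\<And>t l q. \<lbrakk>\<forall>s\<le>t. multiplier A c act s l q; \<forall>s. 0 \<le> q s; 0 \<le> l;
      l + (\<Sum>\<alpha>\<in>UNIV. q 1 $ \<alpha>) = 1\<rbrakk> \<Longrightarrow> q (Suc t) \<le> b t"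
    by blast
  \<comment> \<open>\<open>q 0\<close> occurs in no multiplier condition, so its box is the point 0.
    The \<open>sup 0\<close> keeps 0 in every box, for the truncation below.\<close>
  define B where "B t = (case t of 0 \<Rightarrow> 0 | Suc k \<Rightarrow> sup 0 (b k))" for t
  define K where "K = {0..1::real} \<times> (\<Pi>\<^sub>E t\<in>UNIV. {0..B t})"
  define H where "H = {z::real \<times> (nat \<Rightarrow> real^'n). fst z + (\<Sum>\<alpha>\<in>UNIV. snd z 1 $ \<alpha>) = 1}"
  define M where "M T = H \<inter> {(l, q). multiplier A c act T l q}" for T
  have "compact (\<Pi>\<^sub>E t\<in>UNIV. {0..B t})"
  proof -
    \<comment> \<open>Tychonoff: each factor is an order interval, hence a closed box.\<close>
    have "compactin (product_topology (\<lambda>_. euclidean) UNIV) (\<Pi>\<^sub>E t\<in>UNIV. {0..B t})"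
      unfolding compactin_PiE by (simp add: interval_cbox_cart)
    then show ?thesis by (simp add: euclidean_product_topology)
  qed
  then have compact_K: "compact K" unfolding K_def by (intro compact_Times) auto
  have closed_M: "closed (M T)" for T
  proof -
    have "closed H" unfolding H_def
      by (intro closed_Collect_eq continuous_on_add continuous_on_sum continuous_on_component
          continuous_on_snd_coordinate continuous_on_const continuous_on_fst continuous_on_id)
    then show ?thesis unfolding M_def by (intro closed_Int closed_multiplier)
  qed
  have fip: "K \<inter> (\<Inter>T\<in>I. M T) \<noteq> {}" if I: "finite I" for I
  proof -
    obtain T where T: "\<And>t. t \<in> I \<Longrightarrow> t \<le> T" using finite_nat_set_iff_bounded_le I by auto
    obtain l q where lq: "0 \<le> l" "\<And>t. 0 \<le> q t" "\<And>t. t \<le> T \<Longrightarrow> multiplier A c act t l q"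
      "l \<noteq> 0 \<or> (\<exists>t\<le>T. q (Suc t) \<noteq> 0)" using fin[of T] by auto
    define n where "n = l + (\<Sum>\<alpha>\<in>UNIV. q 1 $ \<alpha>)"
    have q1: "0 \<le> q 1 $ \<alpha>" for \<alpha> using lq(2)[of 1] by (simp add: less_eq_vec_def)
    then have sum: "0 \<le> (\<Sum>\<alpha>\<in>UNIV. q 1 $ \<alpha>)" by (intro sum_nonneg) auto
    \<comment> \<open>Otherwise \<open>l\<close> and \<open>q 1\<close> vanish by nonnegativity, and
      \<open>multiplier_vanishes\<close> contradicts nontriviality at this horizon.\<close>
    have "n \<noteq> 0"
    proof
      assume "n = 0"
      then have l: "l = 0" and "(\<Sum>\<alpha>\<in>UNIV. q 1 $ \<alpha>) = 0" using sum lq(1) by (auto simp: n_def)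
      then have "q 1 = 0" using q1 by (simp add: sum_nonneg_eq_0_iff vec_eq_iff)
      have "q (Suc t) = 0" if "t \<le> T" for t
        by (rule multiplier_vanishes[where A = A and c = c and act = act and T = T])
          (use lq(2,3) pos l \<open>q 1 = 0\<close> that in auto)
      then show False using lq(4) l by auto
    qed
    then have n: "0 < n" using sum lq(1) by (simp add: n_def)
    define l' where "l' = inverse n * l"
    define q' where "q' t = inverse n *\<^sub>R q t" for t
    have m': "multiplier A c act t l' q'" if "t \<le> T" for t
      unfolding l'_def q'_def using multiplier_scale[OF lq(3)[OF that]] .
    have l': "0 \<le> l'" using n lq(1) by (simp add: l'_def)
    have q': "0 \<le> q' t" for t using n lq(2)[of t] by (simp add: q'_def less_eq_vec_def)
    have "l' + (\<Sum>\<alpha>\<in>UNIV. q' 1 $ \<alpha>) = inverse n * n"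
      by (simp add: l'_def q'_def n_def sum_distrib_left distrib_left)
    then have sum': "l' + (\<Sum>\<alpha>\<in>UNIV. q' 1 $ \<alpha>) = 1" using n by simp
    \<comment> \<open>Bounds are known only up to \<open>Suc T\<close>, so later entries become 0.
      Conditions up to \<open>T\<close> see no entry beyond \<open>Suc T\<close> and
      survive.\<close>
    define q'' where "q'' t = (if 1 \<le> t \<and> t \<le> Suc T then q' t else 0)" for t
    have "multiplier A c act t l' q''" if "t \<le> T" for t
      using m'[OF that] that by (auto simp: multiplier_def q''_def)
    moreover have "q'' t \<in> {0..B t}" for t
    proof (cases t)
      case 0
      then show ?thesis by (simp add: q''_def B_def)
    next
      case (Suc k)
      then show ?thesis using b[of k l' q'] m' l' q' sum'
        by (auto simp: q''_def B_def intro: le_supI2)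
    qed
    moreover have "l' \<le> 1"
      using sum' sum_nonneg[of UNIV "\<lambda>\<alpha>. q' 1 $ \<alpha>"] q'[of 1] by (simp add: less_eq_vec_def)
    moreover have "q'' 1 = q' 1" by (simp add: q''_def)
    ultimately have "(l', q'') \<in> K \<inter> (\<Inter>T\<in>I. M T)"
      using T l' sum' by (auto simp: K_def M_def H_def)
    then show ?thesis by blast
  qed
  have "K \<inter> (\<Inter>T\<in>UNIV. M T) \<noteq> {}"
    by (rule compact_imp_fip_image[OF compact_K closed_M fip])
  then obtain l q where lq: "(l, q) \<in> K" "\<And>T. (l, q) \<in> M T" by auto
  show ?thesis
  proof (rule that[of l q])
    \<comment> \<open>The normalisation in \<open>H\<close> survives in the common element and
      excludes zero.\<close>
    show "(l, q 1) \<noteq> (0, 0)" using lq(2)[of 0] by (auto simp: M_def H_def)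
  qed (use lq in \<open>auto simp: K_def M_def PiE_def Pi_def\<close>)
qed

section \<open>Translation back to functionals and partial differentials\<close>

theorem theorem3p2:
  fixes X :: "nat \<Rightarrow> (real^'n) set"
    and U :: "nat \<Rightarrow> (real^'d) set"
    and f :: "nat \<Rightarrow> (real^'n) \<times> (real^'d) \<Rightarrow> real^'n"
    and \<phi> :: "nat \<Rightarrow> (real^'n) \<times> (real^'d) \<Rightarrow> real"
    and \<sigma> :: "real^'n"
    and xh :: "nat \<Rightarrow> real^'n"
    and uh :: "nat \<Rightarrow> real^'d"
    and j :: nat
  assumes X: "\<And>t. open (X t)" "\<And>t. X t \<noteq> {}"
    and U: "\<And>t. U t \<noteq> {}"
    and f: "\<And>t. f t \<in> X t \<times> U t \<rightarrow> X (Suc t)"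
    and \<sigma>: "\<sigma> \<in> X 0"
    and j: "j \<in> {1, 2, 3}"
    and sol: "j = 1 \<Longrightarrow> solves_P1 X U f \<phi> \<sigma> (xh, uh)"
             "j = 2 \<Longrightarrow> solves_P2 X U f \<phi> \<sigma> (xh, uh)"
             "j = 3 \<Longrightarrow> solves_P3 X U f \<phi> \<sigma> (xh, uh)"
    and i: "\<And>t. uh t \<in> interior (U t)"
    and ii: "\<And>t. gateaux_differentiable (X t \<times> U t) (\<phi> t) (xh t, uh t)"
            "\<And>t. gateaux_differentiable (X t \<times> U t) (f t) (xh t, uh t)"
    and iii: "\<And>t \<alpha>. f t (xh t, uh t) $ \<alpha> > xh (Suc t) $ \<alpha> \<Longrightarrow>
                lsc_at (X t \<times> U t) (\<lambda>z. f t z $ \<alpha>) (xh t, uh t)"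
    and v: "\<And>t \<alpha> \<beta>. t \<ge> 1 \<Longrightarrow> partial_x (X t \<times> U t) (f t) (xh t, uh t) \<alpha> \<beta> \<ge> 0"
           "\<And>t \<alpha>. t \<ge> 1 \<Longrightarrow> partial_x (X t \<times> U t) (f t) (xh t, uh t) \<alpha> \<alpha> > 0"
  shows "\<exists>(l0 :: real) (p :: nat \<Rightarrow> (real^'n) \<Rightarrow>\<^sub>L real).
    (l0, p 1) \<noteq> (0, 0) \<and>
    (l0 \<ge> 0 \<and> (\<forall>t\<ge>1. dual_nonneg (p t))) \<and>
    (\<forall>t \<alpha>. dual_coord (p (Suc t)) \<alpha> * (f t (xh t, uh t) $ \<alpha> - xh (Suc t) $ \<alpha>) = 0) \<and>
    (\<forall>t\<ge>1. blinfun_apply (p t) =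
       (\<lambda>v. blinfun_apply (p (Suc t)) (gateaux_deriv1 (X t \<times> U t) (f t) (xh t, uh t) v)
            + l0 * gateaux_deriv1 (X t \<times> U t) (\<phi> t) (xh t, uh t) v)) \<and>
    (\<forall>t. (\<lambda>v. blinfun_apply (p (Suc t)) (gateaux_deriv2 (X t \<times> U t) (f t) (xh t, uh t) v)
            + l0 * gateaux_deriv2 (X t \<times> U t) (\<phi> t) (xh t, uh t) v) = (\<lambda>v. 0))"
proof -
  define A where "A t = gateaux_deriv (X t \<times> U t) (f t) (xh t, uh t)" for t
  define c where "c t = gateaux_deriv (X t \<times> U t) (\<phi> t) (xh t, uh t)" for t
  define act where "act t = {\<alpha>. f t (xh t, uh t) $ \<alpha> = xh (Suc t) $ \<alpha>}" for t
  have partial: "partial_x (X t \<times> U t) (f t) (xh t, uh t) \<alpha> \<beta> = A t (axis \<beta> 1, 0) $ \<alpha>" for t \<alpha> \<beta>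
    by (simp add: partial_x_def matrix_def gateaux_deriv1_eq A_def)
  have adm: "(xh, uh) \<in> Adm X U f \<sigma>"
    using j sol by (auto simp: solves_P1_def solves_P2_def solves_P3_def Dom_def)
  have fin: "\<exists>l q. 0 \<le> l \<and> (\<forall>t. 0 \<le> q t) \<and> (\<forall>t\<le>T. multiplier A c act t l q) \<and>
      (l \<noteq> 0 \<or> (\<exists>t\<le>T. q (Suc t) \<noteq> 0))" for T
  proof (rule finite_horizon_multipliers[of A c T act])
    show "linear (A t)" "linear (c t)" for t
      unfolding A_def c_def by (intro linear_gateaux_deriv ii)+
    show "(\<Sum>t\<le>T. c t (y t, w t)) \<le> 0"
      if "y 0 = 0" "\<And>t. t > T \<Longrightarrow> y t = 0 \<and> w t = 0"
        "\<And>t \<alpha>. t \<le> T \<Longrightarrow> \<alpha> \<in> act t \<Longrightarrow> y (Suc t) $ \<alpha> < A t (y t, w t) $ \<alpha>" for y w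
      unfolding c_def
    proof (rule no_improving_direction[where X = X and U = U and f = f and \<sigma> = \<sigma> and xh = xh and uh = uh])
      show "(\<Sum>t\<le>T. \<phi> t (x t, u t)) \<le> (\<Sum>t\<le>T. \<phi> t (xh t, uh t))"
        if "(x, u) \<in> Adm X U f \<sigma>" "\<And>t. t > T \<Longrightarrow> x t = xh t \<and> u t = uh t" for x u
        using truncated_optimality[OF j sol that] by simp
      show "y (Suc t) $ \<alpha> < gateaux_deriv (X t \<times> U t) (f t) (xh t, uh t) (y t, w t) $ \<alpha>"
        if "t \<le> T" "f t (xh t, uh t) $ \<alpha> = xh (Suc t) $ \<alpha>" for t \<alpha>
        using \<open>\<And>t \<alpha>. t \<le> T \<Longrightarrow> \<alpha> \<in> act t \<Longrightarrow> y (Suc t) $ \<alpha> < A t (y t, w t) $ \<alpha>\<close> that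
        by (simp add: A_def act_def)
    qed (use X(1) adm i ii iii that in auto)
  qed blast
  obtain l q where lq: "0 \<le> l" "\<And>t. 0 \<le> q t" "\<And>t. multiplier A c act t l q" "(l, q 1) \<noteq> (0, 0)"
    by (rule infinite_horizon_multipliers[of A c act, OF _ _ fin]) (use v partial in auto)
  have coord: "dual_coord (blinfun_inner_left x) \<alpha> = x $ \<alpha>" for x :: "real^'n" and \<alpha>
    by (simp add: dual_coord_def inner_axis inner_commute)
  show ?thesis
  proof (intro exI[of _ l] exI[of _ "\<lambda>t. blinfun_inner_left (q t)"] conjI allI impI ext)
    show "(l, blinfun_inner_left (q 1)) \<noteq> (0, 0)"
    proof
      assume *: "(l, blinfun_inner_left (q 1)) = (0, 0)"
      \<comment> \<open>Evaluating the functional at its own representing vector gives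
        \<open>q 1 \<bullet> q 1 = 0\<close>.\<close>
      then have "blinfun_apply (blinfun_inner_left (q 1)) (q 1) = blinfun_apply 0 (q 1)"
        by (simp only: prod.inject)
      then have "q 1 = 0" by simp
      with * lq(4) show False by simp
    qed
    show "dual_nonneg (blinfun_inner_left (q t))" for t
      using lq(2)[of t] by (simp add: dual_nonneg_def coord less_eq_vec_def)
    show "dual_coord (blinfun_inner_left (q (Suc t))) \<alpha> * (f t (xh t, uh t) $ \<alpha> - xh (Suc t) $ \<alpha>) = 0" for t \<alpha>
      using lq(3)[of t] by (auto simp: coord multiplier_def act_def)
    show "blinfun_apply (blinfun_inner_left (q t)) v =
        blinfun_apply (blinfun_inner_left (q (Suc t))) (gateaux_deriv1 (X t \<times> U t) (f t) (xh t, uh t) v)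
        + l * gateaux_deriv1 (X t \<times> U t) (\<phi> t) (xh t, uh t) v" if "1 \<le> t" for t v
    proof -
      have "q t \<bullet> v = q (Suc t) \<bullet> A t (v, 0) + l * c t (v, 0)"
        using lq(3)[of t] that by (simp add: multiplier_def)
      then show ?thesis by (simp add: gateaux_deriv1_eq A_def c_def inner_commute)
    qed
    show "blinfun_apply (blinfun_inner_left (q (Suc t))) (gateaux_deriv2 (X t \<times> U t) (f t) (xh t, uh t) v)
        + l * gateaux_deriv2 (X t \<times> U t) (\<phi> t) (xh t, uh t) v = 0" for t v
    proof -
      have "q (Suc t) \<bullet> A t (0, v) + l * c t (0, v) = 0"
        using lq(3)[of t] by (simp add: multiplier_def)
      then show ?thesis by (simp add: gateaux_deriv2_eq A_def c_def inner_commute)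
    qed
  qed (rule lq(1))
qed

end
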